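(* Let $X\in\mathbb{R}^{n\times p}$ be a centered data matrix with columns $X_1,\dots,X_p$, and let $a,k$ be positive integers with $a\le n$, $k\le p$. Consider the problem $$(P)\qquad \max_{s\in\{0,1\}^p,\;U\in\mathbb{R}^{n\times a}}\ \sum_{i=1}^p s_i\sum_{j=1}^a (X_i^TU_j)^2\quad\text{s.t.}\quad \sum_{i=1}^p s_i\le k,\ \ U^TU=I_a,$$ and, for $\eta\ge 0$, the problem $$(Q_\eta)\qquad \max_{s\in\{0,1\}^p}\ \sum_{i=1}^p s_i\|X_i\|^2\quad\text{s.t.}\quad \sum_{i=1}^p s_i\le k,\ \ \text{and for all }\sigma\subset[p]:\ \eta(s^\sigma)>\eta\ \Rightarrow\ \sum_{i\in\sigma}s_i\le|\sigma|-1 .$$ Let $(s^o,U[s^o])$ be an optimal solution of $(P)$, let $\eta\ge\eta(s^o)$, and let $s^A$ be an optimal solution of $(Q_\eta)$. Then $$\pi(s^o)-\pi(s^A)\le\eta,$$ i.e. the difference between the optimal value of $(P)$ and the value $\sum_{i=1}^p s^A_i\sum_{j=1}^a(X_i^TU[s^A]_j)^2$ of its objective at $s^A$ is bounded by $\eta$. Furthermore, this bound is tight: for every $\rho<1$ there are positive integers $n,p,a,k$ with $a\le n$ and $k\le p$, a centered data matrix $X\in\mathbb{R}^{n\times p}$, an optimal solution $(s^o,U[s^o])$ of $(P)$, a real number $\eta\ge\eta(s^o)$ with $\eta>0$, and an optimal solution $s^A$ of $(Q_\eta)$, such that $\pi(s^o)-\pi(s^A)\ge\rho\,\eta$.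
   Context: $[p]=\{1,\dots,p\}$. For $\sigma\subset[p]$, $s^\sigma\in\{0,1\}^p$ is the indicator vector of $\sigma$. For $s\in\{0,1\}^p$, $X(s)$ is the matrix obtained from $X$ by deleting every column $X_i$ with $s_i=0$ (empty matrix of norm $0$ if $s=0$). $U[s]$ is any element of $\operatorname{argmax}\{\mathrm{tr}(U^TX(s)X(s)^TU): U\in\mathbb{R}^{n\times a},\ U^TU=I_a\}$, with columns $U[s]_j$; $\eta(s)=\|X(s)-U[s]U[s]^TX(s)\|_F^2$ and $\pi(s)=\|U[s]U[s]^TX(s)\|_F^2=\sum_{i=1}^p s_i\sum_{j=1}^a(X_i^TU[s]_j)^2$, with $\|\cdot\|_F$ the Frobenius norm. Centered means that each column of $X$ sums to zero. *)

theory Defs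
  imports Complex_Main "Jordan_Normal_Form.Matrix"
begin

text \<open>Dimensions vary inside the statement, so matrices are carrier based, with
  rows and columns indexed from 0: the index set [p] becomes \<open>{..<p}\<close>.\<close>

definition mat_trace :: "real mat \<Rightarrow> real" where
  "mat_trace A = (\<Sum>i<dim_row A. A $$ (i, i))"

definition frob_norm :: "real mat \<Rightarrow> real" where
  "frob_norm A = sqrt (\<Sum>i<dim_row A. \<Sum>j<dim_col A. (A $$ (i, j))\<^sup>2)"

definition eucl_norm :: "real vec \<Rightarrow> real" where
  "eucl_norm v = sqrt (\<Sum>i<dim_vec v. (v $ i)\<^sup>2)"

definition centered :: "real mat \<Rightarrow> bool" where
  "centered X \<longleftrightarrow> (\<forall>j<dim_col X. (\<Sum>i<dim_row X. X $$ (i, j)) = 0)"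

definition binary_vecs :: "nat \<Rightarrow> real vec set" where
  "binary_vecs p = {s \<in> carrier_vec p. \<forall>i<p. s $ i \<in> {0, 1}}"

definition indicator_vec :: "nat \<Rightarrow> nat set \<Rightarrow> real vec" where
  "indicator_vec p \<sigma> = vec p (\<lambda>i. if i \<in> \<sigma> then 1 else 0)"

definition orthonormal_mats :: "nat \<Rightarrow> nat \<Rightarrow> real mat set" where
  "orthonormal_mats n a = {U \<in> carrier_mat n a. U\<^sup>T * U = 1\<^sub>m a}"

definition select_cols :: "real mat \<Rightarrow> real vec \<Rightarrow> real mat" where
  "select_cols X s =
     mat_of_cols (dim_row X) (map (col X) (filter (\<lambda>i. s $ i \<noteq> 0) [0..<dim_col X]))"

text \<open>\<open>optimal_choice X a U\<close>: the function \<open>U\<close> picks, for every binary \<open>s\<close>, one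
  (arbitrary) element \<open>U s\<close> of the argmax.\<close>

definition optimal_choice :: "real mat \<Rightarrow> nat \<Rightarrow> (real vec \<Rightarrow> real mat) \<Rightarrow> bool" where
  "optimal_choice X a U \<longleftrightarrow>
     (\<forall>s \<in> binary_vecs (dim_col X).
        is_arg_max (\<lambda>V. mat_trace (V\<^sup>T * select_cols X s * (select_cols X s)\<^sup>T * V))
          (\<lambda>V. V \<in> orthonormal_mats (dim_row X) a) (U s))"

definition eta_val :: "real mat \<Rightarrow> (real vec \<Rightarrow> real mat) \<Rightarrow> real vec \<Rightarrow> real" where
  "eta_val X U s = (frob_norm (select_cols X s - U s * (U s)\<^sup>T * select_cols X s))\<^sup>2"

definition pi_val :: "real mat \<Rightarrow> (real vec \<Rightarrow> real mat) \<Rightarrow> real vec \<Rightarrow> real" where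
  "pi_val X U s = (frob_norm (U s * (U s)\<^sup>T * select_cols X s))\<^sup>2"

definition P_objective :: "real mat \<Rightarrow> real vec \<Rightarrow> real mat \<Rightarrow> real" where
  "P_objective X s U =
     (\<Sum>i<dim_col X. s $ i * (\<Sum>j<dim_col U. (col X i \<bullet> col U j)\<^sup>2))"

definition P_optimal :: "real mat \<Rightarrow> nat \<Rightarrow> nat \<Rightarrow> real vec \<Rightarrow> real mat \<Rightarrow> bool" where
  "P_optimal X a k s U \<longleftrightarrow>
     is_arg_max (\<lambda>(t, V). P_objective X t V)
       (\<lambda>(t, V). t \<in> binary_vecs (dim_col X) \<and> (\<Sum>i<dim_col X. t $ i) \<le> real k
          \<and> V \<in> orthonormal_mats (dim_row X) a) (s, U)"

definition Q_optimal ::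
    "real mat \<Rightarrow> nat \<Rightarrow> (real vec \<Rightarrow> real mat) \<Rightarrow> real \<Rightarrow> real vec \<Rightarrow> bool" where
  "Q_optimal X k U \<eta> s \<longleftrightarrow>
     is_arg_max (\<lambda>t. \<Sum>i<dim_col X. t $ i * (eucl_norm (col X i))\<^sup>2)
       (\<lambda>t. t \<in> binary_vecs (dim_col X) \<and> (\<Sum>i<dim_col X. t $ i) \<le> real k
          \<and> (\<forall>\<sigma>. \<sigma> \<subseteq> {..<dim_col X} \<longrightarrow>
               eta_val X U (indicator_vec (dim_col X) \<sigma>) > \<eta> \<longrightarrow>
               (\<Sum>i\<in>\<sigma>. t $ i) \<le> real (card \<sigma>) - 1)) s"

end

theory Submission
  imports Defs
begin

text \<open>Writing \<open>\<tau>(s) = \<Sum> s\<^sub>i \<parallel>X\<^sub>i\<parallel>\<^sup>2\<close> for the objective of \<open>(Q\<^sub>\<eta>)\<close>, Pythagoras gives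
  \<open>\<tau> = \<pi> + \<eta>(\<cdot>)\<close>. The residual \<open>\<eta>(\<cdot>)\<close> is a minimum over all orthonormal frames, hence
  monotone in the support, so \<open>s\<^sup>o\<close> is feasible for \<open>(Q\<^sub>\<eta>)\<close> and \<open>\<tau>(s\<^sup>o) \<le> \<tau>(s\<^sup>A)\<close>. The constraint
  for the support of \<open>s\<^sup>A\<close> itself forces \<open>\<eta>(s\<^sup>A) \<le> \<eta>\<close>, and so
  \<open>\<pi>(s\<^sup>o) - \<pi>(s\<^sup>A) \<le> \<eta>(s\<^sup>A) - \<eta>(s\<^sup>o) \<le> \<eta>\<close>.
  Equality is attained by the columns \<open>u, u, w\<close> with \<open>u\<close>, \<open>w\<close> orthogonal of equal norm, \<open>a = 1\<close>
  and \<open>k = 2\<close>: \<open>(P)\<close> selects \<open>{u, u}\<close>, while \<open>{u, w}\<close> is also optimal for \<open>(Q\<^sub>\<eta>)\<close>, \<open>\<eta> = \<parallel>u\<parallel>\<^sup>2\<close>.\<close>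

section \<open>Frobenius norms, traces and Pythagoras for orthogonal projections\<close>

lemma frob_norm_sq: "(frob_norm M)\<^sup>2 = mat_trace (M\<^sup>T * M)"
proof -
  have "(frob_norm M)\<^sup>2 = (\<Sum>i<dim_row M. \<Sum>j<dim_col M. (M $$ (i, j))\<^sup>2)"
    unfolding frob_norm_def by (simp add: sum_nonneg)
  also have "\<dots> = (\<Sum>j<dim_col M. \<Sum>i<dim_row M. (M $$ (i, j))\<^sup>2)"
    by (rule sum.swap)
  also have "\<dots> = mat_trace (M\<^sup>T * M)"
    by (simp add: mat_trace_def scalar_prod_def power2_eq_square lessThan_atLeast0)
  finally show ?thesis .
qed

lemma frob_norm_sq_cols: "(frob_norm M)\<^sup>2 = (\<Sum>l<dim_col M. (eucl_norm (col M l))\<^sup>2)"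
  by (simp add: frob_norm_sq mat_trace_def scalar_prod_def eucl_norm_def sum_nonneg
      power2_eq_square[symmetric] lessThan_atLeast0)

lemma frob_norm_sq_mult:
  assumes "V \<in> carrier_mat n a" "A \<in> carrier_mat n m"
  shows "(frob_norm (V\<^sup>T * A))\<^sup>2 = (\<Sum>l<m. \<Sum>j<a. (col A l \<bullet> col V j)\<^sup>2)"
proof -
  have "(frob_norm (V\<^sup>T * A))\<^sup>2 = (\<Sum>j<a. \<Sum>l<m. (col V j \<bullet> col A l)\<^sup>2)"
    using assms unfolding frob_norm_def by (simp add: sum_nonneg)
  also have "\<dots> = (\<Sum>j<a. \<Sum>l<m. (col A l \<bullet> col V j)\<^sup>2)"
    using assms by (intro sum.cong refl) (simp add: comm_scalar_prod[of _ n])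
  finally show ?thesis by (simp only: sum.swap[of _ "{..<m}"])
qed

text \<open>The product is the Gram matrix of \<open>A\<^sup>T * V\<close>, so its trace is a
  squared Frobenius norm. This links the trace criterion of \<open>optimal_choice\<close> to the
  objective of (P).\<close>

lemma trace_sandwich:
  assumes V: "V \<in> carrier_mat n a" and A: "A \<in> carrier_mat n m"
  shows "mat_trace (V\<^sup>T * A * A\<^sup>T * V) = (\<Sum>l<m. \<Sum>j<a. (col A l \<bullet> col V j)\<^sup>2)"
proof -
  have "V\<^sup>T * A * A\<^sup>T * V = (A\<^sup>T * V)\<^sup>T * (A\<^sup>T * V)"
    unfolding transpose_mult[OF transpose_carrier_mat[THEN iffD2, OF A] V] transpose_transpose
    using V A by (intro assoc_mult_mat[of _ a m _ n _ a] mult_carrier_mat[of _ a n _ m]) auto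
  then have "mat_trace (V\<^sup>T * A * A\<^sup>T * V) = (frob_norm (A\<^sup>T * V))\<^sup>2"
    by (simp only: frob_norm_sq)
  also have "\<dots> = (\<Sum>j<a. \<Sum>l<m. (col V j \<bullet> col A l)\<^sup>2)"
    using A V by (rule frob_norm_sq_mult)
  also have "\<dots> = (\<Sum>j<a. \<Sum>l<m. (col A l \<bullet> col V j)\<^sup>2)"
    using assms by (intro sum.cong refl) (simp add: comm_scalar_prod[of _ n])
  finally show ?thesis by (simp only: sum.swap[of _ "{..<m}"])
qed

text \<open>Put \<open>B = V * V\<^sup>T * A\<close> and \<open>C = V\<^sup>T * A\<close>. Since
  \<open>V\<^sup>T * V = 1\<^sub>m a\<close>, the products \<open>B\<^sup>T * B\<close>,
  \<open>B\<^sup>T * A\<close> and \<open>A\<^sup>T * B\<close> all equal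
  \<open>C\<^sup>T * C\<close>, so the cross terms in the Gram matrix of \<open>A - B\<close>
  collapse.\<close>

lemma projection_decomposition:
  assumes V: "V \<in> orthonormal_mats n a" and A: "A \<in> carrier_mat n m"
  shows frob_norm_projection:
      "(frob_norm (V * V\<^sup>T * A))\<^sup>2 = (\<Sum>l<m. \<Sum>j<a. (col A l \<bullet> col V j)\<^sup>2)"
    and frob_norm_residual:
      "(frob_norm (A - V * V\<^sup>T * A))\<^sup>2 = (frob_norm A)\<^sup>2 - (frob_norm (V * V\<^sup>T * A))\<^sup>2"
proof -
  have Vc[simp]: "V \<in> carrier_mat n a" and VV: "V\<^sup>T * V = 1\<^sub>m a"
    using V by (auto simp: orthonormal_mats_def)
  note A[simp]
  define C where "C = V\<^sup>T * A"
  have C[simp]: "C \<in> carrier_mat a m" unfolding C_def by (rule mult_carrier_mat[of _ a n]) auto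
  define B where "B = V * V\<^sup>T * A"
  have BVC: "B = V * C"
    unfolding B_def C_def by (rule assoc_mult_mat[of _ n a _ n _ m]) auto
  have B[simp]: "B \<in> carrier_mat n m" unfolding BVC by (rule mult_carrier_mat[of _ n a]) auto
  have VB: "V\<^sup>T * B = C"
  proof -
    have "V\<^sup>T * B = V\<^sup>T * V * C"
      unfolding BVC by (rule assoc_mult_mat[symmetric, of _ a n _ a _ m]) auto
    then show ?thesis using VV C by simp
  qed
  have BT: "B\<^sup>T = C\<^sup>T * V\<^sup>T"
    unfolding BVC by (rule transpose_mult[of _ n a _ m]) auto
  have CT: "C\<^sup>T = A\<^sup>T * V"
    unfolding C_def by (simp add: transpose_mult[of _ a n _ m])
  have BB: "B\<^sup>T * B = C\<^sup>T * C"
    unfolding BT by (subst assoc_mult_mat[of _ m a _ n _ m]) (auto simp: VB)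
  have BA: "B\<^sup>T * A = C\<^sup>T * C"
    unfolding BT by (subst assoc_mult_mat[of _ m a _ n _ m]) (auto simp: C_def[symmetric])
  have AB: "A\<^sup>T * B = C\<^sup>T * C"
    unfolding BVC CT by (rule assoc_mult_mat[symmetric, of _ m n _ a _ m]) auto
  have "(frob_norm B)\<^sup>2 = (frob_norm C)\<^sup>2"
    by (simp only: frob_norm_sq BB)
  then show "(frob_norm (V * V\<^sup>T * A))\<^sup>2 = (\<Sum>l<m. \<Sum>j<a. (col A l \<bullet> col V j)\<^sup>2)"
    by (simp only: frob_norm_sq_mult[OF Vc A] C_def B_def)
  have "(A - B)\<^sup>T = A\<^sup>T - B\<^sup>T"
    using carrier_matD[OF A] carrier_matD[OF B] by (intro eq_matI) auto
  then have "(A - B)\<^sup>T * (A - B) = (A\<^sup>T - B\<^sup>T) * (A - B)"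
    by (rule arg_cong)
  also have "\<dots> = A\<^sup>T * (A - B) - B\<^sup>T * (A - B)"
    by (rule minus_mult_distrib_mat[of _ m n _ _ m]) (auto intro: minus_carrier_mat)
  also have "A\<^sup>T * (A - B) = A\<^sup>T * A - C\<^sup>T * C"
    unfolding AB[symmetric] by (rule mult_minus_distrib_mat[of _ m n _ m]) auto
  also have "B\<^sup>T * (A - B) = C\<^sup>T * C - C\<^sup>T * C"
    unfolding BA[symmetric] using mult_minus_distrib_mat[of "B\<^sup>T" m n A m B, OF _ A B] B BA BB
    by (simp only: transpose_carrier_mat)
  \<comment> \<open>The last bracket is a zero matrix left unsimplified; it contributes nothing to
    the trace.\<close>
  finally have E: "(A - B)\<^sup>T * (A - B) = (A\<^sup>T * A - C\<^sup>T * C) - (C\<^sup>T * C - C\<^sup>T * C)" .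
  have tr: "mat_trace (M - N) = mat_trace M - mat_trace N"
    if "M \<in> carrier_mat m m" "N \<in> carrier_mat m m" for M N :: "real mat"
    using that by (auto simp: mat_trace_def sum_subtractf)
  have "A\<^sup>T * A \<in> carrier_mat m m" "C\<^sup>T * C \<in> carrier_mat m m"
    by (auto intro: mult_carrier_mat[of _ m n] mult_carrier_mat[of _ m a])
  then have "(frob_norm (A - B))\<^sup>2 = mat_trace (A\<^sup>T * A) - mat_trace (B\<^sup>T * B)"
    unfolding frob_norm_sq E BB by (simp only: tr minus_carrier_mat)
  then show "(frob_norm (A - V * V\<^sup>T * A))\<^sup>2 = (frob_norm A)\<^sup>2 - (frob_norm (V * V\<^sup>T * A))\<^sup>2"
    by (simp only: frob_norm_sq B_def)
qed

section \<open>Column selection as a weighted sum over all columns\<close>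

lemma select_cols_carrier:
  "select_cols X s \<in> carrier_mat (dim_row X) (dim_col (select_cols X s))"
  by (rule carrier_matI) (simp_all add: select_cols_def)

text \<open>For binary \<open>s\<close>, keeping the columns with \<open>s $ i \<noteq> 0\<close>
  amounts to weighting column \<open>i\<close> by \<open>s $ i\<close>. The function
  \<open>f\<close> is arbitrary so that the result serves both squared norms and squared inner
  products.\<close>

lemma sum_select_cols:
  fixes f :: "real vec \<Rightarrow> real"
  assumes s: "s \<in> binary_vecs (dim_col X)"
  shows "(\<Sum>l<dim_col (select_cols X s). f (col (select_cols X s) l))
       = (\<Sum>i<dim_col X. s $ i * f (col X i))"
proof -
  define xs where "xs = filter (\<lambda>i. s $ i \<noteq> 0) [0..<dim_col X]"
  have lt: "xs ! l < dim_col X" if "l < length xs" for l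
    using nth_mem[OF that] by (auto simp: xs_def)
  have "(\<Sum>l<dim_col (select_cols X s). f (col (select_cols X s) l))
      = (\<Sum>l<length xs. f (col X (xs ! l)))"
    using lt by (intro sum.cong) (auto simp: select_cols_def xs_def[symmetric] intro!: arg_cong[of _ _ f] col_mat_of_cols)
  also have "\<dots> = sum_list (map (\<lambda>i. f (col X i)) xs)"
    by (simp add: sum_list_sum_nth lessThan_atLeast0)
  also have "\<dots> = (\<Sum>i<dim_col X. if s $ i \<noteq> 0 then f (col X i) else 0)"
    unfolding xs_def sum_list_map_filter'
    by (simp add: interv_sum_list_conv_sum_set_nat lessThan_atLeast0)
  also have "\<dots> = (\<Sum>i<dim_col X. s $ i * f (col X i))"
    using s by (intro sum.cong) (auto simp: binary_vecs_def)
  finally show ?thesis .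
qed

text \<open>The objective of (Q), which for binary \<open>s\<close> is the squared Frobenius norm of
  \<open>select_cols X s\<close>.\<close>

definition total_val :: "real mat \<Rightarrow> real vec \<Rightarrow> real" where
  "total_val X s = (\<Sum>i<dim_col X. s $ i * (eucl_norm (col X i))\<^sup>2)"

context
  fixes X :: "real mat" and a :: nat and s :: "real vec" and V :: "real mat"
  assumes s: "s \<in> binary_vecs (dim_col X)" and V: "V \<in> orthonormal_mats (dim_row X) a"
begin

lemma V_carrier: "V \<in> carrier_mat (dim_row X) a"
  using V by (simp add: orthonormal_mats_def)

lemma sum_select_cols_eq_P_objective:
  "(\<Sum>l<dim_col (select_cols X s). \<Sum>j<a. (col (select_cols X s) l \<bullet> col V j)\<^sup>2) = P_objective X s V"
  unfolding sum_select_cols[OF s, of "\<lambda>v. \<Sum>j<a. (v \<bullet> col V j)\<^sup>2"] P_objective_def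
    carrier_matD(2)[OF V_carrier] ..

lemma trace_eq_P_objective:
  "mat_trace (V\<^sup>T * select_cols X s * (select_cols X s)\<^sup>T * V) = P_objective X s V"
  unfolding trace_sandwich[OF V_carrier select_cols_carrier]
  by (rule sum_select_cols_eq_P_objective)

lemma frob_norm_projection_eq_P_objective:
  "(frob_norm (V * V\<^sup>T * select_cols X s))\<^sup>2 = P_objective X s V"
  unfolding frob_norm_projection[OF V select_cols_carrier]
  by (rule sum_select_cols_eq_P_objective)

lemma frob_norm_residual_eq:
  "(frob_norm (select_cols X s - V * V\<^sup>T * select_cols X s))\<^sup>2 = total_val X s - P_objective X s V"
  unfolding frob_norm_residual[OF V select_cols_carrier] frob_norm_projection_eq_P_objective
  unfolding frob_norm_sq_cols sum_select_cols[OF s, of "\<lambda>v. (eucl_norm v)\<^sup>2"] total_val_def ..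

text \<open>The difference is a squared residual norm. Monotonicity of the residual applies this to
  a frame chosen for a different selection, hence the arbitrary \<open>V\<close>.\<close>

lemma P_objective_le_total: "P_objective X s V \<le> total_val X s"
  by (rule diff_ge_0_iff_ge[THEN iffD1]) (simp only: frob_norm_residual_eq[symmetric] zero_le_power2)

end

section \<open>Optimal frames and monotonicity of the residual\<close>

lemma optimal_choice_iff:
  "optimal_choice X a U \<longleftrightarrow> (\<forall>s \<in> binary_vecs (dim_col X). U s \<in> orthonormal_mats (dim_row X) a \<and>
     (\<forall>V \<in> orthonormal_mats (dim_row X) a. P_objective X s V \<le> P_objective X s (U s)))"
  unfolding optimal_choice_def is_arg_max_linorder
  by (intro ball_cong refl) (metis trace_eq_P_objective)

lemma optimal_choiceD:
  assumes "optimal_choice X a U" "s \<in> binary_vecs (dim_col X)"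
  shows "U s \<in> orthonormal_mats (dim_row X) a"
    and "V \<in> orthonormal_mats (dim_row X) a \<Longrightarrow> P_objective X s V \<le> P_objective X s (U s)"
  using assms unfolding optimal_choice_iff by blast+

lemma pi_val_eq:
  assumes "optimal_choice X a U" "s \<in> binary_vecs (dim_col X)"
  shows "pi_val X U s = P_objective X s (U s)"
  unfolding pi_val_def
  using assms(2) optimal_choiceD(1)[OF assms] by (rule frob_norm_projection_eq_P_objective)

lemma eta_val_eq:
  assumes "optimal_choice X a U" "s \<in> binary_vecs (dim_col X)"
  shows "eta_val X U s = total_val X s - P_objective X s (U s)"
  unfolding eta_val_def
  using assms(2) optimal_choiceD(1)[OF assms] by (rule frob_norm_residual_eq)

lemma indicator_vec_binary: "indicator_vec p \<sigma> \<in> binary_vecs p"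
  by (auto simp: indicator_vec_def binary_vecs_def)

lemma binary_vec_eq_indicator:
  assumes "s \<in> binary_vecs p"
  shows "s = indicator_vec p {i. i < p \<and> s $ i = 1}"
  using assms by (intro eq_vecI) (auto simp: indicator_vec_def binary_vecs_def)

lemma eta_val_mono:
  assumes U: "optimal_choice X a U"
    and s: "s \<in> binary_vecs (dim_col X)" and t: "t \<in> binary_vecs (dim_col X)"
    and le: "\<And>i. i < dim_col X \<Longrightarrow> s $ i \<le> t $ i"
  shows "eta_val X U s \<le> eta_val X U t"
proof -
  define V where "V = U t"
  have V: "V \<in> orthonormal_mats (dim_row X) a"
    unfolding V_def using U t by (rule optimal_choiceD)
  \<comment> \<open>For a column \<open>v\<close> of \<open>X\<close>, \<open>r v\<close> is its
    squared distance from the column span of \<open>V\<close>.\<close>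
  define r where "r v = (eucl_norm v)\<^sup>2 - (\<Sum>j<dim_col V. (v \<bullet> col V j)\<^sup>2)" for v
  have r: "total_val X z - P_objective X z V = (\<Sum>i<dim_col X. z $ i * r (col X i))" for z
    by (simp add: total_val_def P_objective_def r_def right_diff_distrib sum_subtractf)
  have "r (col X i) \<ge> 0" if i: "i < dim_col X" for i
  proof -
    \<comment> \<open>Bessel's inequality for one column is read off from
      \<open>P_objective_le_total\<close> at the singleton selection.\<close>
    have "(\<Sum>l<dim_col X. indicator_vec (dim_col X) {i} $ l * r (col X l)) = r (col X i)"
      using i by (simp add: indicator_vec_def if_distrib[of "\<lambda>x. x * _"] cong: if_cong)
    then show ?thesis
      using r[of "indicator_vec (dim_col X) {i}"]
        P_objective_le_total[OF indicator_vec_binary[of "dim_col X" "{i}"] V] by simp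
  qed
  then have "total_val X s - P_objective X s V \<le> total_val X t - P_objective X t V"
    unfolding r using le by (intro sum_mono mult_right_mono) auto
  moreover have "P_objective X s V \<le> P_objective X s (U s)"
    using U s V by (rule optimal_choiceD)
  ultimately show ?thesis
    by (simp add: eta_val_eq[OF U s] eta_val_eq[OF U t] V_def)
qed

section \<open>The feasible set of (Q) and the bound\<close>

definition Q_feasible :: "real mat \<Rightarrow> nat \<Rightarrow> (real vec \<Rightarrow> real mat) \<Rightarrow> real \<Rightarrow> real vec \<Rightarrow> bool" where
  "Q_feasible X k U \<eta> t \<longleftrightarrow> t \<in> binary_vecs (dim_col X) \<and> (\<Sum>i<dim_col X. t $ i) \<le> real k
     \<and> (\<forall>\<sigma>. \<sigma> \<subseteq> {..<dim_col X} \<longrightarrow> eta_val X U (indicator_vec (dim_col X) \<sigma>) > \<eta> \<longrightarrow>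
          (\<Sum>i\<in>\<sigma>. t $ i) \<le> real (card \<sigma>) - 1)"

lemma Q_optimal_iff:
  "Q_optimal X k U \<eta> s \<longleftrightarrow>
     Q_feasible X k U \<eta> s \<and> (\<forall>t. Q_feasible X k U \<eta> t \<longrightarrow> total_val X t \<le> total_val X s)"
  unfolding Q_optimal_def is_arg_max_linorder Q_feasible_def total_val_def ..

text \<open>If the residual of \<open>t\<close> exceeded \<eta>, the constraint for the support of
  \<open>t\<close> would be violated by \<open>t\<close> itself. Conversely, a violated constraint
  gives a set inside the support of \<open>t\<close> with residual above \<eta>, which monotonicity
  passes on to \<open>t\<close>.\<close>

lemma Q_feasible_iff:
  assumes U: "optimal_choice X a U"
  shows "Q_feasible X k U \<eta> t \<longleftrightarrow>
    t \<in> binary_vecs (dim_col X) \<and> (\<Sum>i<dim_col X. t $ i) \<le> real k \<and> eta_val X U t \<le> \<eta>"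
proof (intro iffI; (elim conjE)?)
  assume t: "Q_feasible X k U \<eta> t"
  then have tb: "t \<in> binary_vecs (dim_col X)" and le: "(\<Sum>i<dim_col X. t $ i) \<le> real k"
    by (auto simp: Q_feasible_def)
  define \<sigma> where "\<sigma> = {i. i < dim_col X \<and> t $ i = 1}"
  have "(\<Sum>i\<in>\<sigma>. t $ i) = real (card \<sigma>)" by (simp add: \<sigma>_def)
  then have "\<not> (\<Sum>i\<in>\<sigma>. t $ i) \<le> real (card \<sigma>) - 1" by simp
  moreover have "\<sigma> \<subseteq> {..<dim_col X}" by (auto simp: \<sigma>_def)
  ultimately have "\<not> eta_val X U (indicator_vec (dim_col X) \<sigma>) > \<eta>"
    using t unfolding Q_feasible_def by blast
  then have "eta_val X U (indicator_vec (dim_col X) \<sigma>) \<le> \<eta>" by simp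
  then show "t \<in> binary_vecs (dim_col X) \<and> (\<Sum>i<dim_col X. t $ i) \<le> real k \<and> eta_val X U t \<le> \<eta>"
    using tb le binary_vec_eq_indicator[OF tb] by (simp add: \<sigma>_def)
next
  assume tb: "t \<in> binary_vecs (dim_col X)" and le: "(\<Sum>i<dim_col X. t $ i) \<le> real k"
    and eta: "eta_val X U t \<le> \<eta>"
  have "(\<Sum>i\<in>\<sigma>. t $ i) \<le> real (card \<sigma>) - 1"
    if \<sigma>: "\<sigma> \<subseteq> {..<dim_col X}" and gt: "eta_val X U (indicator_vec (dim_col X) \<sigma>) > \<eta>" for \<sigma>
  proof -
    have fin: "finite \<sigma>" using \<sigma> finite_subset by blast
    have bin: "t $ i \<in> {0, 1}" if "i < dim_col X" for i
      using tb that by (auto simp: binary_vecs_def)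
    \<comment> \<open>Otherwise \<open>t\<close> dominates the indicator of \<sigma>. This also
      rules out empty \<sigma>, whose constraint would read \<open>0 \<le> -1\<close>.\<close>
    have "\<exists>i\<in>\<sigma>. t $ i \<noteq> 1"
    proof (rule ccontr)
      assume "\<not> (\<exists>i\<in>\<sigma>. t $ i \<noteq> 1)"
      then have "indicator_vec (dim_col X) \<sigma> $ i \<le> t $ i" if "i < dim_col X" for i
        using bin[OF that] that by (auto simp: indicator_vec_def)
      then have "eta_val X U (indicator_vec (dim_col X) \<sigma>) \<le> eta_val X U t"
        by (intro eta_val_mono[OF U indicator_vec_binary tb])
      then show False using gt eta by simp
    qed
    then obtain i where i: "i \<in> \<sigma>" "t $ i = 0" using bin \<sigma> by blast
    have "(\<Sum>l\<in>\<sigma>. t $ l) = (\<Sum>l\<in>\<sigma> - {i}. t $ l)"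
      using sum.remove[OF fin i(1), of "($) t"] i(2) by simp
    also have "\<dots> \<le> (\<Sum>l\<in>\<sigma> - {i}. 1)"
    proof (rule sum_mono)
      fix l assume "l \<in> \<sigma> - {i}"
      then have "t $ l \<in> {0, 1}" using bin \<sigma> by blast
      then show "t $ l \<le> 1" by auto
    qed
    also have "\<dots> = real (card \<sigma>) - 1"
      using card.remove[OF fin i(1)] by simp
    finally show ?thesis .
  qed
  then show "Q_feasible X k U \<eta> t" using tb le by (simp add: Q_feasible_def)
qed

lemma P_optimal_iff:
  "P_optimal X a k s V \<longleftrightarrow> s \<in> binary_vecs (dim_col X) \<and> (\<Sum>i<dim_col X. s $ i) \<le> real k
     \<and> V \<in> orthonormal_mats (dim_row X) a
     \<and> (\<forall>t W. t \<in> binary_vecs (dim_col X) \<longrightarrow> (\<Sum>i<dim_col X. t $ i) \<le> real k \<longrightarrow>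
          W \<in> orthonormal_mats (dim_row X) a \<longrightarrow> P_objective X t W \<le> P_objective X s V)"
  unfolding P_optimal_def is_arg_max_linorder split_paired_All prod.case by blast

lemma pi_gap_le:
  assumes U: "optimal_choice X a U" and P: "P_optimal X a k s_o (U s_o)"
    and eta: "eta_val X U s_o \<le> \<eta>" and Q: "Q_optimal X k U \<eta> s_A"
  shows "P_objective X s_o (U s_o) - P_objective X s_A (U s_A) \<le> \<eta>"
    and "pi_val X U s_o - pi_val X U s_A \<le> \<eta>"
proof -
  have o: "s_o \<in> binary_vecs (dim_col X)" "(\<Sum>i<dim_col X. s_o $ i) \<le> real k"
    using P by (auto simp: P_optimal_iff)
  have A: "s_A \<in> binary_vecs (dim_col X)" "eta_val X U s_A \<le> \<eta>"
    using Q by (auto simp: Q_optimal_iff Q_feasible_iff[OF U])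
  \<comment> \<open>The assumption \<open>eta\<close> makes \<open>s_o\<close> a feasible competitor
    of \<open>s_A\<close> in (Q).\<close>
  have "total_val X s_o \<le> total_val X s_A"
    using Q o eta by (auto simp: Q_optimal_iff Q_feasible_iff[OF U])
  moreover have "eta_val X U s_o \<ge> 0" by (simp add: eta_val_def)
  ultimately show "P_objective X s_o (U s_o) - P_objective X s_A (U s_A) \<le> \<eta>"
    using A(2) by (simp add: eta_val_eq[OF U o(1)] eta_val_eq[OF U A(1)])
  then show "pi_val X U s_o - pi_val X U s_A \<le> \<eta>"
    by (simp add: pi_val_eq[OF U o(1)] pi_val_eq[OF U A(1)])
qed

section \<open>An example attaining the bound\<close>

text \<open>The columns are \<open>u, u, w\<close> with \<open>u = (1, -1, 0, 0)\<close> and \<open>w = (0, 0, 1, -1)\<close>.\<close>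

definition tight_X :: "real mat" where
  "tight_X = mat_of_rows_list 3 [[1, 1, 0], [-1, -1, 0], [0, 0, 1], [0, 0, -1]]"

text \<open>The normalised direction of \<open>u\<close> if a copy of \<open>u\<close> is selected,
  else that of \<open>w\<close>. For one \<open>u\<close> together with \<open>w\<close> both
  directions are optimal and the tie goes to \<open>u\<close>; for the empty selection every frame
  is optimal.\<close>

definition tight_U :: "real vec \<Rightarrow> real mat" where
  "tight_U s = (if s $ 0 = 0 \<and> s $ 1 = 0
     then mat_of_cols_list 4 [[0, 0, 1 / sqrt 2, - 1 / sqrt 2]]
     else mat_of_cols_list 4 [[1 / sqrt 2, - 1 / sqrt 2, 0, 0]])"

lemma tight_X_dim [simp]: "dim_row tight_X = 4" "dim_col tight_X = 3"
  by (simp_all add: tight_X_def mat_of_rows_list_def)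

lemma sum_lessThan_numerals:
  fixes f :: "nat \<Rightarrow> real"
  shows "(\<Sum>i<1. f i) = f 0" "(\<Sum>i<3. f i) = f 0 + f 1 + f 2"
    "(\<Sum>i<4. f i) = f 0 + f 1 + f 2 + f 3"
  by (simp_all add: eval_nat_numeral)

lemma all_less_3: "(\<forall>i<3. Q i) \<longleftrightarrow> Q 0 \<and> Q 1 \<and> Q (2::nat)"
  by (auto simp: numeral_3_eq_3 numeral_2_eq_2 All_less_Suc)

lemma tight_X_index:
  "tight_X $$ (0, 0) = 1" "tight_X $$ (0, Suc 0) = 1" "tight_X $$ (0, 2) = 0"
  "tight_X $$ (Suc 0, 0) = -1" "tight_X $$ (Suc 0, Suc 0) = -1" "tight_X $$ (Suc 0, 2) = 0"
  "tight_X $$ (2, 0) = 0" "tight_X $$ (2, Suc 0) = 0" "tight_X $$ (2, 2) = 1"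
  "tight_X $$ (3, 0) = 0" "tight_X $$ (3, Suc 0) = 0" "tight_X $$ (3, 2) = -1"
  by (simp_all add: tight_X_def mat_of_rows_list_def)

lemma tight_X_centered: "centered tight_X"
  by (simp only: centered_def tight_X_dim all_less_3 sum_lessThan_numerals tight_X_index One_nat_def) simp

lemma tight_total_val: "total_val tight_X s = 2 * (s $ 0 + s $ 1 + s $ 2)"
  by (simp add: total_val_def eucl_norm_def sum_lessThan_numerals tight_X_index)

lemma orthonormal_mats_one:
  "V \<in> orthonormal_mats n 1 \<longleftrightarrow> V \<in> carrier_mat n 1 \<and> (\<Sum>i<n. (V $$ (i, 0))\<^sup>2) = 1"
  by (auto simp: orthonormal_mats_def mat_eq_iff scalar_prod_def power2_eq_square lessThan_atLeast0)

lemma tight_P_objective: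
  assumes "V \<in> carrier_mat 4 1"
  shows "P_objective tight_X s V = (s $ 0 + s $ 1) * (V $$ (0, 0) - V $$ (1, 0))\<^sup>2
     + s $ 2 * (V $$ (2, 0) - V $$ (3, 0))\<^sup>2"
proof -
  have dims: "dim_row V = 4" "dim_col V = 1" using assms by auto
  show ?thesis
    by (simp add: P_objective_def sum_lessThan_numerals scalar_prod_def
        lessThan_atLeast0[symmetric] tight_X_index dims[simplified] algebra_simps power2_eq_square)
qed

text \<open>As \<open>u\<close> and \<open>w\<close> are orthogonal with squared norm 2, the
  weighted sum of the \<open>X\<^sub>i * X\<^sub>i\<^sup>T\<close> has eigenvalues
  \<open>2 * (s $ 0 + s $ 1)\<close>, \<open>2 * s $ 2\<close> and 0. The number \<open>c\<close>
  bounds both weights, and the elementary inequality \<open>sq\<close> replaces the spectral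
  argument.\<close>

lemma tight_P_objective_le:
  assumes V: "V \<in> orthonormal_mats 4 1" and "s $ 0 + s $ 1 \<le> c" "s $ 2 \<le> c" "0 \<le> c"
  shows "P_objective tight_X s V \<le> 2 * c"
proof -
  define v where "v i = V $$ (i, 0)" for i
  have Vc: "V \<in> carrier_mat 4 1" and nrm: "(v 0)\<^sup>2 + (v 1)\<^sup>2 + (v 2)\<^sup>2 + (v 3)\<^sup>2 = 1"
    using V unfolding orthonormal_mats_one sum_lessThan_numerals v_def by auto
  have sq: "(x - y)\<^sup>2 \<le> 2 * x\<^sup>2 + 2 * y\<^sup>2" for x y :: real
    using zero_le_power2[of "x + y"] by (simp add: power2_sum power2_diff)
  have "P_objective tight_X s V = (s $ 0 + s $ 1) * (v 0 - v 1)\<^sup>2 + s $ 2 * (v 2 - v 3)\<^sup>2"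
    using tight_P_objective[OF Vc] by (simp add: v_def)
  also have "\<dots> \<le> c * (v 0 - v 1)\<^sup>2 + c * (v 2 - v 3)\<^sup>2"
    using assms by (intro add_mono mult_right_mono) auto
  also have "\<dots> = c * ((v 0 - v 1)\<^sup>2 + (v 2 - v 3)\<^sup>2)"
    by (simp add: algebra_simps)
  also have "\<dots> \<le> c * 2"
    using nrm sq[of "v 0" "v 1"] sq[of "v 2" "v 3"] assms(4) by (intro mult_left_mono) linarith+
  finally show ?thesis by simp
qed

lemma tight_U_orthonormal: "tight_U s \<in> orthonormal_mats 4 1"
  unfolding orthonormal_mats_one
  by (auto simp: tight_U_def mat_of_cols_list_def sum_lessThan_numerals power_divide)

lemma tight_P_objective_U:
  "P_objective tight_X s (tight_U s)
     = (if s $ 0 = 0 \<and> s $ 1 = 0 then 2 * s $ 2 else 2 * (s $ 0 + s $ 1))"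
proof -
  have c: "tight_U s \<in> carrier_mat 4 1"
    using tight_U_orthonormal by (auto simp: orthonormal_mats_def)
  have "(1 / sqrt 2 - - 1 / sqrt 2)\<^sup>2 = (2::real)"
    by (simp add: power_divide add_divide_distrib[symmetric])
  then show ?thesis
    unfolding tight_P_objective[OF c]
    by (auto simp: tight_U_def mat_of_cols_list_def)
qed

lemma binary_vecs_3:
  "s \<in> binary_vecs 3 \<longleftrightarrow> dim_vec s = 3 \<and> s $ 0 \<in> {0, 1} \<and> s $ 1 \<in> {0, 1} \<and> s $ 2 \<in> {0, 1}"
  by (simp only: binary_vecs_def mem_Collect_eq all_less_3 carrier_vec_def)

lemma tight_optimal_choice: "optimal_choice tight_X 1 tight_U"
  unfolding optimal_choice_iff tight_X_dim
proof (intro ballI conjI tight_U_orthonormal)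
  fix s V assume s: "s \<in> binary_vecs 3" and V: "V \<in> orthonormal_mats 4 1"
  show "P_objective tight_X s V \<le> P_objective tight_X s (tight_U s)"
    \<comment> \<open>For binary \<open>s\<close>, half the value at \<open>tight_U s\<close> is the
      larger of the weights \<open>s $ 0 + s $ 1\<close> and \<open>s $ 2\<close>, hence an
      admissible \<open>c\<close>.\<close>
    using s tight_P_objective_le[OF V, of s "P_objective tight_X s (tight_U s) / 2"]
    by (auto simp: tight_P_objective_U binary_vecs_3)
qed

text \<open>The residual is zero unless \<open>w\<close> is selected together with a
  \<open>u\<close>; then it is the squared norm of \<open>w\<close>. So at \<eta> = 2 every binary
  vector passes the residual test, and only the cardinality bound of (Q) remains.\<close>

lemma tight_eta_val_le: "s \<in> binary_vecs 3 \<Longrightarrow> eta_val tight_X tight_U s \<le> 2"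
  by (auto simp: eta_val_eq[OF tight_optimal_choice] tight_total_val tight_P_objective_U binary_vecs_3)

lemma tight_P_optimal:
  "P_optimal tight_X 1 2 (indicator_vec 3 {0, 1}) (tight_U (indicator_vec 3 {0, 1}))"
  unfolding P_optimal_iff tight_X_dim
proof (intro conjI allI impI tight_U_orthonormal indicator_vec_binary)
  show "(\<Sum>i<3. indicator_vec 3 {0, 1} $ i) \<le> real 2"
    by (simp add: sum_lessThan_numerals indicator_vec_def)
  fix t W assume t: "t \<in> binary_vecs 3" and W: "W \<in> orthonormal_mats 4 1"
  have "P_objective tight_X t W \<le> 2 * 2"
    using t by (intro tight_P_objective_le[OF W]) (auto simp: binary_vecs_3)
  then show "P_objective tight_X t W
      \<le> P_objective tight_X (indicator_vec 3 {0, 1}) (tight_U (indicator_vec 3 {0, 1}))"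
    by (simp add: tight_P_objective_U indicator_vec_def)
qed

text \<open>All columns have squared norm 2, so any two of them are optimal. The pair
  \<open>u\<close>, \<open>w\<close> is the bad choice, since a single direction cannot capture
  both.\<close>

lemma tight_Q_optimal: "Q_optimal tight_X 2 tight_U 2 (indicator_vec 3 {0, 2})"
  unfolding Q_optimal_iff Q_feasible_iff[OF tight_optimal_choice] tight_X_dim
proof (intro conjI allI impI tight_eta_val_le indicator_vec_binary)
  show "(\<Sum>i<3. indicator_vec 3 {0, 2} $ i) \<le> real 2"
    by (simp add: sum_lessThan_numerals indicator_vec_def)
  fix t assume "t \<in> binary_vecs 3 \<and> (\<Sum>i<3. t $ i) \<le> real 2 \<and> eta_val tight_X tight_U t \<le> 2"
  then show "total_val tight_X t \<le> total_val tight_X (indicator_vec 3 {0, 2})"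
    by (simp add: tight_total_val sum_lessThan_numerals indicator_vec_def)
qed

text \<open>The two copies of \<open>u\<close> are captured completely, with value 4; of
  \<open>u\<close>, \<open>w\<close> only one column is, with value 2.\<close>

lemma tight_pi_gap:
  "pi_val tight_X tight_U (indicator_vec 3 {0, 1}) - pi_val tight_X tight_U (indicator_vec 3 {0, 2}) = 2"
proof -
  have "pi_val tight_X tight_U (indicator_vec 3 \<sigma>)
      = P_objective tight_X (indicator_vec 3 \<sigma>) (tight_U (indicator_vec 3 \<sigma>))" for \<sigma>
    by (rule pi_val_eq[OF tight_optimal_choice]) (simp add: indicator_vec_binary)
  then show ?thesis
    by (simp only: tight_P_objective_U) (simp add: indicator_vec_def)
qed

theorem proposition5:
  shows "(\<forall>(n::nat) (p::nat) (a::nat) (k::nat) (X::real mat) (U::real vec \<Rightarrow> real mat)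
            (s_o::real vec) (s_A::real vec) (\<eta>::real).
            0 < a \<and> a \<le> n \<and> 0 < k \<and> k \<le> p \<and> X \<in> carrier_mat n p \<and> centered X
            \<and> optimal_choice X a U \<and> P_optimal X a k s_o (U s_o)
            \<and> eta_val X U s_o \<le> \<eta> \<and> Q_optimal X k U \<eta> s_A
            \<longrightarrow> pi_val X U s_o - pi_val X U s_A \<le> \<eta>
              \<and> P_objective X s_o (U s_o) - P_objective X s_A (U s_A) \<le> \<eta>)
       \<and> (\<forall>\<rho>::real. \<rho> < 1 \<longrightarrow>
            (\<exists>(n::nat) (p::nat) (a::nat) (k::nat) (X::real mat) (U::real vec \<Rightarrow> real mat)
               (s_o::real vec) (s_A::real vec) (\<eta>::real).
               0 < n \<and> 0 < p \<and> 0 < a \<and> a \<le> n \<and> 0 < k \<and> k \<le> p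
               \<and> X \<in> carrier_mat n p \<and> centered X
               \<and> optimal_choice X a U \<and> P_optimal X a k s_o (U s_o)
               \<and> eta_val X U s_o \<le> \<eta> \<and> 0 < \<eta> \<and> Q_optimal X k U \<eta> s_A
               \<and> pi_val X U s_o - pi_val X U s_A \<ge> \<rho> * \<eta>))"
proof (intro conjI)
  show "\<forall>\<rho>::real. \<rho> < 1 \<longrightarrow>
            (\<exists>(n::nat) (p::nat) (a::nat) (k::nat) (X::real mat) (U::real vec \<Rightarrow> real mat)
               (s_o::real vec) (s_A::real vec) (\<eta>::real).
               0 < n \<and> 0 < p \<and> 0 < a \<and> a \<le> n \<and> 0 < k \<and> k \<le> p
               \<and> X \<in> carrier_mat n p \<and> centered X
               \<and> optimal_choice X a U \<and> P_optimal X a k s_o (U s_o)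
               \<and> eta_val X U s_o \<le> \<eta> \<and> 0 < \<eta> \<and> Q_optimal X k U \<eta> s_A
               \<and> pi_val X U s_o - pi_val X U s_A \<ge> \<rho> * \<eta>)"
  proof (intro allI impI)
    fix \<rho> :: real assume "\<rho> < 1"
    show "\<exists>n p a k X U s_o s_A \<eta>. 0 < n \<and> 0 < p \<and> 0 < a \<and> a \<le> n \<and> 0 < k \<and> k \<le> p
        \<and> X \<in> carrier_mat n p \<and> centered X
        \<and> optimal_choice X a U \<and> P_optimal X a k s_o (U s_o)
        \<and> eta_val X U s_o \<le> \<eta> \<and> 0 < \<eta> \<and> Q_optimal X k U \<eta> s_A
        \<and> pi_val X U s_o - pi_val X U s_A \<ge> \<rho> * \<eta>"
    \<comment> \<open>The witness is the same for every \<rho>: the gap equals \<eta> = 2, so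
      \<open>\<rho> < 1\<close> gives \<open>\<rho> * 2 \<le> 2\<close>.\<close>
    proof (rule exI[of _ 4], rule exI[of _ 3], rule exI[of _ 1], rule exI[of _ 2],
        rule exI[of _ tight_X], rule exI[of _ tight_U], rule exI[of _ "indicator_vec 3 {0, 1}"],
        rule exI[of _ "indicator_vec 3 {0, 2}"], rule exI[of _ 2],
        intro conjI tight_X_centered tight_optimal_choice tight_P_optimal tight_Q_optimal
          tight_eta_val_le indicator_vec_binary)
      show "tight_X \<in> carrier_mat 4 3" by (rule carrier_matI) simp_all
      show "\<rho> * 2 \<le> pi_val tight_X tight_U (indicator_vec 3 {0, 1})
          - pi_val tight_X tight_U (indicator_vec 3 {0, 2})"
        using \<open>\<rho> < 1\<close> unfolding tight_pi_gap by simp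
    qed simp_all
  qed
qed (use pi_gap_le in blast)

end
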